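(* Let $K$ be a field, let $\psi\colon D\to E$ be a morphism of dialgebras over $K$, let $N$ be a positive integer, and let $\Theta_t$ be a deformation of order $N$ of $\psi$. Then the obstruction class $\mathrm{Ob}(\Theta_t)\in CY^3(\psi,\psi)$ is a $3$-cocycle.
   Context: **Dialgebras.** All tensor products and $\mathrm{Hom}$'s are over the field $K$. A dialgebra over $K$ is a $K$-module $D$ with two $K$-bilinear maps $\dashv,\vdash\colon D\otimes D\to D$ (left and right product) such that for all $x,y,z$: (1) $x\dashv(y\dashv z)=(x\dashv y)\dashv z$; (2) $(x\dashv y)\dashv z=x\dashv(y\vdash z)$; (3) $(x\vdash y)\dashv z=x\vdash(y\dashv z)$; (4) $(x\dashv y)\vdash z=x\vdash(y\vdash z)$; (5) $x\vdash(y\vdash z)=(x\vdash y)\vdash z$. A morphism of dialgebras is a $K$-linear map preserving both products. A representation of $D$ is a $K$-module $M$ with left actions $\dashv,\vdash\colon D\otimes M\to M$ and right actions $\dashv,\vdash\colon M\otimes D\to M$ satisfying the fifteen identities obtained from (1)–(5) by letting exactly one of $x,y,z$ lie in $M$. $D$ is a representation of itself; given a morphism $\psi\colon D\to E$, $E$ is a representation of $D$ via $a* e=\psi(a)* e$, $e* a=e*\psi(a)$ for $*\in\{\dashv,\vdash\}$. **Trees.** $Y_n$ is the set of planar binary trees with $n+1$ leaves, numbered $0,\dots,n$ from left to right ("$n$-trees"); $Y_0=\{|\}$, and every $y\in Y_n$ with $n\ge1$ is uniquely a grafting $y=y_1\vee y_2$ (left subtree $y_1$, right subtree $y_2$). The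 two $2$-trees are $[21]=|\vee(|\vee|)$, $[12]=(|\vee|)\vee|$; the five $3$-trees are $[321]=|\vee[21]$, $[312]=|\vee[12]$, $[131]=(|\vee|)\vee(|\vee|)$, $[213]=[21]\vee|$, $[123]=[12]\vee|$. For $y\in Y_n$, $n\ge1$, $d_iy\in Y_{n-1}$ is obtained by deleting the $i$th leaf. For $y\in Y_{n+1}$ define $\circ^y_i\in\{\dashv,\vdash\}$, $0\le i\le n+1$: $\circ^y_0=\dashv$ if $y=|\vee y_1$ for some $y_1$, and $\vdash$ otherwise; for $1\le i\le n$, $\circ^y_i=\dashv$ if the $i$th leaf is the left branch at its vertex, and $\vdash$ if it is the right branch; $\circ^y_{n+1}=\vdash$ if $y=y_1\vee|$ for some $y_1$, and $\dashv$ otherwise. **Dialgebra cochains.** For a representation $M$ of $D$, $CY^n(D,M)=\mathrm{Hom}(K[Y_n]\otimes D^{\otimes n},M)$ for $n\ge0$, and $\delta=\sum_{i=0}^{n+1}(-1)^i\delta^i\colon CY^n(D,M)\to CY^{n+1}(D,M)$, where $(\delta^if)(y\otimes(a_1,\dots,a_{n+1}))$ equals $a_1\circ^y_0f(d_0y\otimes(a_2,\dots,a_{n+1}))$ if $i=0$; $f(d_iy\otimes(\dots,a_{i-1},a_i\circ^y_ia_{i+1},a_{i+2},\dots))$ if $1\le i\le n$; and $f(d_{n+1}y\otimes(a_1,\dots,a_n))\circ^y_{n+1}a_{n+1}$ if $i=n+1$. **Deformation complex.** For $n\ge1$ put $CY^n(\psi,\psi)=CY^n(D,D)\times CY^n(E,E)\times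 CY^{n-1}(D,E)$ and $\delta(\xi;\pi;\varphi)=(\delta\xi;\ \delta\pi;\ \psi\xi-\pi\psi-\delta\varphi)\in CY^{n+1}(\psi,\psi)$, where $(\psi\xi)(y\otimes(a_1,\dots,a_n))=\psi(\xi(y\otimes(a_1,\dots,a_n)))$ and $(\pi\psi)(y\otimes(a_1,\dots,a_n))=\pi(y\otimes(\psi(a_1),\dots,\psi(a_n)))$. This is a cochain complex. **Deformations of order $N$.** A pair $(F^l;F^r)$ of $K$-bilinear maps $D\otimes D\to D$ is identified with $F\in CY^2(D,D)$, $F([21]\otimes(a,b))=F^l(a,b)$, $F([12]\otimes(a,b))=F^r(a,b)$; a $K$-linear map $D\to E$ is identified with an element of $CY^1(D,E)$. A deformation of order $N$ of $\psi$ is a triple $\Theta_t=(f_{D,t};f_{E,t};\Psi_t)=\sum_{i=0}^N\theta_it^i$, $\theta_i=(F_{D,i};F_{E,i};\psi_i)\in CY^2(\psi,\psi)$, with $f_{D,t}=\sum_{i=0}^NF_{D,i}t^i$, $f_{E,t}=\sum_{i=0}^NF_{E,i}t^i$, $\Psi_t=\sum_{i=0}^N\psi_it^i$, such that: $F^l_{D,0},F^r_{D,0}$ (resp. $F^l_{E,0},F^r_{E,0}$) are the products $\dashv,\vdash$ of $D$ (resp. $E$) and $\psi_0=\psi$; the products $f^l_{D,t},f^r_{D,t}$ satisfy the five dialgebra axioms modulo $t^{N+1}$, and likewise $f^l_{E,t},f^r_{E,t}$; and $\sum_{i=0}^n\psi_iF^*_{D,n-i}(a,b)=\sum_{i+j+k=n,\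 i,j,k\ge0}F^*_{E,i}(\psi_j(a),\psi_k(b))$ for all $a,b\in D$, $0\le n\le N$, $*\in\{l,r\}$. **Obstruction class.** For $F,G\in CY^2(D,D)$ the pre-Lie product $F\circ G\in CY^3(D,D)$ takes the following values on $y\otimes(a,b,c)$: for $y=[321]$: $F^l(G^l(a,b),c)-F^l(a,G^l(b,c))$; for $y=[312]$: $F^l(G^l(a,b),c)-F^l(a,G^r(b,c))$; for $y=[131]$: $F^l(G^r(a,b),c)-F^r(a,G^l(b,c))$; for $y=[213]$: $F^r(G^l(a,b),c)-F^r(a,G^r(b,c))$; for $y=[123]$: $F^r(G^r(a,b),c)-F^r(a,G^r(b,c))$; similarly for $E$. For $\Theta_t$ of order $N$, $\mathrm{Ob}(\Theta_t)=(\mathrm{Ob}_D;\mathrm{Ob}_E;\mathrm{Ob}_\psi)\in CY^3(\psi,\psi)$, where $\mathrm{Ob}_D=\sum_{i+j=N+1,\ i,j>0}F_{D,i}\circ F_{D,j}$, $\mathrm{Ob}_E=\sum_{i+j=N+1,\ i,j>0}F_{E,i}\circ F_{E,j}$, and $\mathrm{Ob}_\psi\in CY^2(D,E)$ is $\mathrm{Ob}_\psi([21]\otimes(a,b))=\sum'F^l_{E,i}(\psi_j(a),\psi_k(b))-\sum_{i=1}^N\psi_iF^l_{D,N+1-i}(a,b)$ and $\mathrm{Ob}_\psi([12]\otimes(a,b))=\sum'F^r_{E,i}(\psi_j(a),\psi_k(b))-\sum_{i=1}^N\psi_iF^r_{D,N+1-i}(a,b)$, with $\sum'$ the sum over all integer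 triples $(i,j,k)$ with $0\le i,j,k\le N$ and $i+j+k=N+1$. *)

theory Defs
  imports "HOL-Computational_Algebra.Formal_Power_Series"
begin

section \<open>Dialgebras, morphisms, representations\<close>

text \<open>Products (and actions) come in pairs, indexed by \<^verbatim>\<open>Dashv\<close> (left) and \<^verbatim>\<open>Vdash\<close> (right).\<close>

datatype dop = Dashv | Vdash

text \<open>The five dialgebra identities, up to a relation \<open>R\<close>. The maps \<open>p\<close>, \<open>q\<close> form
  \<open>x * (y * z)\<close> (outer, inner) and \<open>p'\<close>, \<open>q'\<close> form \<open>(x * y) * z\<close> (outer, inner). They are kept
  apart so that \<open>x\<close>, \<open>y\<close>, \<open>z\<close> may have different types, as in a representation; for a
  dialgebra all four are the same map and \<open>R\<close> is equality.\<close>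

definition dialgebra_identities ::
  "('w \<Rightarrow> 'w \<Rightarrow> bool) \<Rightarrow>
   (dop \<Rightarrow> 'x \<Rightarrow> 'u \<Rightarrow> 'w) \<Rightarrow> (dop \<Rightarrow> 'y \<Rightarrow> 'z \<Rightarrow> 'u) \<Rightarrow>
   (dop \<Rightarrow> 'v \<Rightarrow> 'z \<Rightarrow> 'w) \<Rightarrow> (dop \<Rightarrow> 'x \<Rightarrow> 'y \<Rightarrow> 'v) \<Rightarrow> bool" where
  "dialgebra_identities R p q p' q' \<longleftrightarrow> (\<forall>x y z.
     R (p Dashv x (q Dashv y z)) (p' Dashv (q' Dashv x y) z) \<and>
     R (p' Dashv (q' Dashv x y) z) (p Dashv x (q Vdash y z)) \<and>
     R (p' Dashv (q' Vdash x y) z) (p Vdash x (q Dashv y z)) \<and>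
     R (p' Vdash (q' Dashv x y) z) (p Vdash x (q Vdash y z)) \<and>
     R (p Vdash x (q Vdash y z)) (p' Vdash (q' Vdash x y) z))"

definition bilinear_over ::
  "('k::field \<Rightarrow> 'a::ab_group_add \<Rightarrow> 'a) \<Rightarrow> ('k \<Rightarrow> 'b::ab_group_add \<Rightarrow> 'b) \<Rightarrow>
   ('k \<Rightarrow> 'c::ab_group_add \<Rightarrow> 'c) \<Rightarrow> ('a \<Rightarrow> 'b \<Rightarrow> 'c) \<Rightarrow> bool" where
  "bilinear_over sA sB sC h \<longleftrightarrow>
     (\<forall>a. Vector_Spaces.linear sB sC (\<lambda>b. h a b)) \<and>
     (\<forall>b. Vector_Spaces.linear sA sC (\<lambda>a. h a b))"

locale dialgebra = vector_space scale
  for scale :: "'k::field \<Rightarrow> 'd::ab_group_add \<Rightarrow> 'd" +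
  fixes mult :: "dop \<Rightarrow> 'd \<Rightarrow> 'd \<Rightarrow> 'd"
  assumes bilinear_mult: "bilinear_over scale scale scale (mult s)"
    and identities: "dialgebra_identities (=) mult mult mult mult"

locale dialgebra_morphism =
  D: dialgebra sD mD + E: dialgebra sE mE
  for sD :: "'k::field \<Rightarrow> 'd::ab_group_add \<Rightarrow> 'd" and mD :: "dop \<Rightarrow> 'd \<Rightarrow> 'd \<Rightarrow> 'd"
    and sE :: "'k \<Rightarrow> 'e::ab_group_add \<Rightarrow> 'e" and mE :: "dop \<Rightarrow> 'e \<Rightarrow> 'e \<Rightarrow> 'e" +
  fixes \<psi> :: "'d \<Rightarrow> 'e"
  assumes linear_hom: "Vector_Spaces.linear sD sE \<psi>"
    and hom_mult: "\<psi> (mD s a b) = mE s (\<psi> a) (\<psi> b)"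

locale dialgebra_representation =
  D: dialgebra sD mD + M: vector_space sM
  for sD :: "'k::field \<Rightarrow> 'd::ab_group_add \<Rightarrow> 'd" and mD :: "dop \<Rightarrow> 'd \<Rightarrow> 'd \<Rightarrow> 'd"
    and sM :: "'k \<Rightarrow> 'm::ab_group_add \<Rightarrow> 'm" +
  fixes lact :: "dop \<Rightarrow> 'd \<Rightarrow> 'm \<Rightarrow> 'm" and ract :: "dop \<Rightarrow> 'm \<Rightarrow> 'd \<Rightarrow> 'm"
  assumes bilinear_lact: "bilinear_over sD sM sM (lact s)"
    and bilinear_ract: "bilinear_over sM sD sM (ract s)"
    and identities_x: "dialgebra_identities (=) ract mD ract ract"
    and identities_y: "dialgebra_identities (=) lact ract ract lact"
    and identities_z: "dialgebra_identities (=) lact lact lact mD"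

lemma (in dialgebra) representation_self:
  "dialgebra_representation scale mult scale mult mult"
  by unfold_locales (use bilinear_mult identities in auto)

abbreviation (input) pullback_lact :: "(dop \<Rightarrow> 'e \<Rightarrow> 'e \<Rightarrow> 'e) \<Rightarrow> ('d \<Rightarrow> 'e) \<Rightarrow> dop \<Rightarrow> 'd \<Rightarrow> 'e \<Rightarrow> 'e" where
  "pullback_lact mE \<psi> \<equiv> \<lambda>s a e. mE s (\<psi> a) e"

abbreviation (input) pullback_ract :: "(dop \<Rightarrow> 'e \<Rightarrow> 'e \<Rightarrow> 'e) \<Rightarrow> ('d \<Rightarrow> 'e) \<Rightarrow> dop \<Rightarrow> 'e \<Rightarrow> 'd \<Rightarrow> 'e" where
  "pullback_ract mE \<psi> \<equiv> \<lambda>s e a. mE s e (\<psi> a)"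

lemma (in dialgebra_morphism) representation_pullback:
  "dialgebra_representation sD mD sE (pullback_lact mE \<psi>) (pullback_ract mE \<psi>)"
proof unfold_locales
  fix s
  show "bilinear_over sD sE sE (\<lambda>a e. mE s (\<psi> a) e)"
    using E.bilinear_mult[of s] Vector_Spaces.linear_compose[OF linear_hom, of sE]
    by (auto simp: bilinear_over_def o_def)
  show "bilinear_over sE sD sE (\<lambda>e a. mE s e (\<psi> a))"
    using E.bilinear_mult[of s] Vector_Spaces.linear_compose[OF linear_hom, of sE]
    by (auto simp: bilinear_over_def o_def)
qed (use E.identities in \<open>simp_all add: dialgebra_identities_def hom_mult\<close>)


section \<open>Planar binary trees\<close>

datatype ptree = Leaf | Graft ptree ptree

fun leaves :: "ptree \<Rightarrow> nat" where
  "leaves Leaf = 1"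
| "leaves (Graft l r) = leaves l + leaves r"

definition ntrees :: "nat \<Rightarrow> ptree set" where
  "ntrees n = {y. leaves y = n + 1}"

definition tree1 :: ptree where "tree1 = Graft Leaf Leaf"

definition tree21 :: ptree where "tree21 = Graft Leaf tree1"
definition tree12 :: ptree where "tree12 = Graft tree1 Leaf"

definition tree321 :: ptree where "tree321 = Graft Leaf tree21"
definition tree312 :: ptree where "tree312 = Graft Leaf tree12"
definition tree131 :: ptree where "tree131 = Graft tree1 tree1"
definition tree213 :: ptree where "tree213 = Graft tree21 Leaf"
definition tree123 :: ptree where "tree123 = Graft tree12 Leaf"

text \<open>\<open>del_leaf i y\<close> deletes the leaf with number \<open>i\<close>, counted from \<open>0\<close> on the left; the vertex
  carrying that leaf disappears. The value at the tree with one leaf is a dummy.\<close>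

fun del_leaf :: "nat \<Rightarrow> ptree \<Rightarrow> ptree" where
  "del_leaf i Leaf = Leaf"
| "del_leaf i (Graft l r) =
     (if i < leaves l
      then (if l = Leaf then r else Graft (del_leaf i l) r)
      else (if r = Leaf then l else Graft l (del_leaf (i - leaves l) r)))"

text \<open>Whether leaf \<open>i\<close> is the left branch at the vertex it is attached to.\<close>

fun left_leaf :: "nat \<Rightarrow> ptree \<Rightarrow> bool" where
  "left_leaf i Leaf \<longleftrightarrow> False"
| "left_leaf i (Graft l r) \<longleftrightarrow>
     (if i < leaves l then l = Leaf \<or> left_leaf i l
      else r \<noteq> Leaf \<and> left_leaf (i - leaves l) r)"

text \<open>The operation attached to leaf \<open>i\<close> of the tree \<open>y\<close> with \<open>n + 2\<close> leaves.\<close>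

definition leaf_op :: "nat \<Rightarrow> ptree \<Rightarrow> nat \<Rightarrow> dop" where
  "leaf_op n y i =
     (if i = 0 then (if \<exists>y1. y = Graft Leaf y1 then Dashv else Vdash)
      else if i = n + 1 then (if \<exists>y1. y = Graft y1 Leaf then Vdash else Dashv)
      else (if left_leaf i y then Dashv else Vdash))"


section \<open>Dialgebra cochains\<close>

text \<open>An element of \<open>Hom(K[Y\<^sub>n] \<otimes> D\<^sup>\<otimes>\<^sup>n, M)\<close> is the same as a family, indexed by \<open>Y\<^sub>n\<close>, of
  \<open>n\<close>-linear maps from \<open>D\<close> to \<open>M\<close>. Arguments are passed as a list of length \<open>n\<close>; note that
  \<open>a\<^sub>i\<close> is the list entry with index \<open>i - 1\<close>. Cochains are \<open>0\<close> at trees not in \<open>Y\<^sub>n\<close> and at lists of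
  other lengths, so that equality of cochains is equality of functions.\<close>

type_synonym ('d, 'm) cochain = "ptree \<Rightarrow> 'd list \<Rightarrow> 'm"

definition CY ::
  "('k::field \<Rightarrow> 'd::ab_group_add \<Rightarrow> 'd) \<Rightarrow> ('k \<Rightarrow> 'm::ab_group_add \<Rightarrow> 'm) \<Rightarrow> nat \<Rightarrow>
   ('d, 'm) cochain set" where
  "CY sD sM n =
     {f. (\<forall>y\<in>ntrees n. \<forall>as. length as = n \<longrightarrow>
            (\<forall>i<n. Vector_Spaces.linear sD sM (\<lambda>x. f y (as[i := x])))) \<and>
         (\<forall>y as. y \<notin> ntrees n \<or> length as \<noteq> n \<longrightarrow> f y as = 0)}"

definition coface ::
  "(dop \<Rightarrow> 'd \<Rightarrow> 'd \<Rightarrow> 'd) \<Rightarrow> (dop \<Rightarrow> 'd \<Rightarrow> 'm \<Rightarrow> 'm) \<Rightarrow> (dop \<Rightarrow> 'm \<Rightarrow> 'd \<Rightarrow> 'm) \<Rightarrow>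
   nat \<Rightarrow> nat \<Rightarrow> ('d, 'm) cochain \<Rightarrow> ('d, 'm) cochain" where
  "coface mD lact ract n i f y as =
     (let s = leaf_op n y i; g = f (del_leaf i y) in
      if i = 0 then lact s (hd as) (g (tl as))
      else if i = n + 1 then ract s (g (butlast as)) (last as)
      else g (take (i - 1) as @ [mD s (as ! (i - 1)) (as ! i)] @ drop (i + 1) as))"

definition cobd ::
  "(dop \<Rightarrow> 'd \<Rightarrow> 'd \<Rightarrow> 'd) \<Rightarrow> (dop \<Rightarrow> 'd \<Rightarrow> 'm \<Rightarrow> 'm) \<Rightarrow> (dop \<Rightarrow> 'm \<Rightarrow> 'd \<Rightarrow> 'm) \<Rightarrow>
   nat \<Rightarrow> ('d, 'm::ab_group_add) cochain \<Rightarrow> ('d, 'm) cochain" where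
  "cobd mD lact ract n f = (\<lambda>y as.
     if y \<in> ntrees (n + 1) \<and> length as = n + 1
     then \<Sum>i=0..n+1. (if even i then coface mD lact ract n i f y as
                        else - coface mD lact ract n i f y as)
     else 0)"


section \<open>The deformation complex of a morphism\<close>

type_synonym ('d, 'e) mcochain = "('d, 'd) cochain \<times> ('e, 'e) cochain \<times> ('d, 'e) cochain"

text \<open>In both definitions below, the degree \<open>n\<close> is meant to be at least \<open>1\<close>.\<close>

definition CY_mor ::
  "('k::field \<Rightarrow> 'd::ab_group_add \<Rightarrow> 'd) \<Rightarrow> ('k \<Rightarrow> 'e::ab_group_add \<Rightarrow> 'e) \<Rightarrow> nat \<Rightarrow>
   ('d, 'e) mcochain set" where
  "CY_mor sD sE n = CY sD sD n \<times> CY sE sE n \<times> CY sD sE (n - 1)"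

fun cobd_mor ::
  "(dop \<Rightarrow> 'd \<Rightarrow> 'd \<Rightarrow> 'd) \<Rightarrow> (dop \<Rightarrow> 'e \<Rightarrow> 'e \<Rightarrow> 'e) \<Rightarrow> ('d \<Rightarrow> 'e) \<Rightarrow> nat \<Rightarrow>
   ('d::ab_group_add, 'e::ab_group_add) mcochain \<Rightarrow> ('d, 'e) mcochain" where
  "cobd_mor mD mE \<psi> n (\<xi>, \<pi>, \<phi>) =
     (cobd mD mD mD n \<xi>,
      cobd mE mE mE n \<pi>,
      \<lambda>y as. \<psi> (\<xi> y as) - \<pi> y (map \<psi> as)
        - cobd mD (pullback_lact mE \<psi>) (pullback_ract mE \<psi>) (n - 1) \<phi> y as)"

definition cocycle_mor ::
  "('k::field \<Rightarrow> 'd::ab_group_add \<Rightarrow> 'd) \<Rightarrow> (dop \<Rightarrow> 'd \<Rightarrow> 'd \<Rightarrow> 'd) \<Rightarrow>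
   ('k \<Rightarrow> 'e::ab_group_add \<Rightarrow> 'e) \<Rightarrow> (dop \<Rightarrow> 'e \<Rightarrow> 'e \<Rightarrow> 'e) \<Rightarrow> ('d \<Rightarrow> 'e) \<Rightarrow> nat \<Rightarrow>
   ('d, 'e) mcochain \<Rightarrow> bool" where
  "cocycle_mor sD mD sE mE \<psi> n \<theta> \<longleftrightarrow>
     \<theta> \<in> CY_mor sD sE n \<and>
     cobd_mor mD mE \<psi> n \<theta> = ((\<lambda>y as. 0), (\<lambda>y as. 0), (\<lambda>y as. 0))"


section \<open>Deformations of finite order\<close>

text \<open>Degree-\<open>2\<close> cochains as pairs of bilinear maps, degree-\<open>1\<close> cochains as linear maps.\<close>

fun bil :: "('d, 'm) cochain \<Rightarrow> dop \<Rightarrow> 'd \<Rightarrow> 'd \<Rightarrow> 'm" where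
  "bil F Dashv a b = F tree21 [a, b]"
| "bil F Vdash a b = F tree12 [a, b]"

definition lin :: "('d, 'm) cochain \<Rightarrow> 'd \<Rightarrow> 'm" where
  "lin \<phi> a = \<phi> tree1 [a]"

text \<open>The components of the coefficient \<open>\<theta>\<^sub>i = (F\<^sub>D\<^sub>,\<^sub>i; F\<^sub>E\<^sub>,\<^sub>i; \<psi>\<^sub>i)\<close>.\<close>

definition FD :: "(nat \<Rightarrow> ('d, 'e) mcochain) \<Rightarrow> nat \<Rightarrow> ('d, 'd) cochain" where
  "FD \<theta> i = fst (\<theta> i)"
definition FE :: "(nat \<Rightarrow> ('d, 'e) mcochain) \<Rightarrow> nat \<Rightarrow> ('e, 'e) cochain" where
  "FE \<theta> i = fst (snd (\<theta> i))"
definition psi :: "(nat \<Rightarrow> ('d, 'e) mcochain) \<Rightarrow> nat \<Rightarrow> 'd \<Rightarrow> 'e" where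
  "psi \<theta> i = lin (snd (snd (\<theta> i)))"

text \<open>The product \<open>f\<^sub>t = \<Sum>\<^sub>i\<^sub>\<le>\<^sub>N F\<^sub>i t\<^sup>i\<close>, extended \<open>K[[t]]\<close>-bilinearly to \<open>D[[t]]\<close>.\<close>

definition tprod ::
  "nat \<Rightarrow> (nat \<Rightarrow> ('d, 'd) cochain) \<Rightarrow> dop \<Rightarrow> 'd::ab_group_add fps \<Rightarrow> 'd fps \<Rightarrow> 'd fps" where
  "tprod N F s u v =
     Abs_fps (\<lambda>n. \<Sum>(i, j, k)\<in>{(i, j, k). i \<le> N \<and> i + j + k = n}.
       bil (F i) s (fps_nth u j) (fps_nth v k))"

definition eq_mod_t :: "nat \<Rightarrow> 'd::zero fps \<Rightarrow> 'd fps \<Rightarrow> bool" where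
  "eq_mod_t m u v \<longleftrightarrow> (\<forall>n<m. fps_nth u n = fps_nth v n)"

text \<open>Only the coefficients \<open>\<theta> 0, \<dots>, \<theta> N\<close> are relevant.\<close>

definition deformation ::
  "('k::field \<Rightarrow> 'd::ab_group_add \<Rightarrow> 'd) \<Rightarrow> (dop \<Rightarrow> 'd \<Rightarrow> 'd \<Rightarrow> 'd) \<Rightarrow>
   ('k \<Rightarrow> 'e::ab_group_add \<Rightarrow> 'e) \<Rightarrow> (dop \<Rightarrow> 'e \<Rightarrow> 'e \<Rightarrow> 'e) \<Rightarrow> ('d \<Rightarrow> 'e) \<Rightarrow> nat \<Rightarrow>
   (nat \<Rightarrow> ('d, 'e) mcochain) \<Rightarrow> bool" where
  "deformation sD mD sE mE \<psi> N \<theta> \<longleftrightarrow>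
     (\<forall>i\<le>N. \<theta> i \<in> CY_mor sD sE 2) \<and>
     bil (FD \<theta> 0) = mD \<and> bil (FE \<theta> 0) = mE \<and> psi \<theta> 0 = \<psi> \<and>
     (let m = tprod N (FD \<theta>) in dialgebra_identities (eq_mod_t (N + 1)) m m m m) \<and>
     (let m = tprod N (FE \<theta>) in dialgebra_identities (eq_mod_t (N + 1)) m m m m) \<and>
     (\<forall>n\<le>N. \<forall>s a b.
        (\<Sum>i=0..n. psi \<theta> i (bil (FD \<theta> (n - i)) s a b)) =
        (\<Sum>(i, j, k)\<in>{(i, j, k). i + j + k = n}.
           bil (FE \<theta> i) s (psi \<theta> j a) (psi \<theta> k b)))"


section \<open>The obstruction class\<close>

definition prelie ::
  "('d, 'd::ab_group_add) cochain \<Rightarrow> ('d, 'd) cochain \<Rightarrow> ('d, 'd) cochain" where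
  "prelie F G y as = (case as of
     [a, b, c] \<Rightarrow>
       (let Fl = bil F Dashv; Fr = bil F Vdash; Gl = bil G Dashv; Gr = bil G Vdash in
        if y = tree321 then Fl (Gl a b) c - Fl a (Gl b c)
        else if y = tree312 then Fl (Gl a b) c - Fl a (Gr b c)
        else if y = tree131 then Fl (Gr a b) c - Fr a (Gl b c)
        else if y = tree213 then Fr (Gl a b) c - Fr a (Gr b c)
        else if y = tree123 then Fr (Gr a b) c - Fr a (Gr b c)
        else 0)
   | _ \<Rightarrow> 0)"

definition Ob_alg ::
  "nat \<Rightarrow> (nat \<Rightarrow> ('d, 'd::ab_group_add) cochain) \<Rightarrow> ('d, 'd) cochain" where
  "Ob_alg N F y as =
     (\<Sum>(i, j)\<in>{(i, j). i + j = N + 1 \<and> i > 0 \<and> j > 0}. prelie (F i) (F j) y as)"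

definition Ob_psi_bil ::
  "nat \<Rightarrow> (nat \<Rightarrow> ('d, 'e::ab_group_add) mcochain) \<Rightarrow> dop \<Rightarrow> 'd \<Rightarrow> 'd \<Rightarrow> 'e" where
  "Ob_psi_bil N \<theta> s a b =
     (\<Sum>(i, j, k)\<in>{(i, j, k). i \<le> N \<and> j \<le> N \<and> k \<le> N \<and> i + j + k = N + 1}.
        bil (FE \<theta> i) s (psi \<theta> j a) (psi \<theta> k b))
     - (\<Sum>i=1..N. psi \<theta> i (bil (FD \<theta> (N + 1 - i)) s a b))"

definition Ob_psi ::
  "nat \<Rightarrow> (nat \<Rightarrow> ('d, 'e::ab_group_add) mcochain) \<Rightarrow> ('d, 'e) cochain" where
  "Ob_psi N \<theta> y as = (case as of
     [a, b] \<Rightarrow>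
       (if y = tree21 then Ob_psi_bil N \<theta> Dashv a b
        else if y = tree12 then Ob_psi_bil N \<theta> Vdash a b
        else 0)
   | _ \<Rightarrow> 0)"

definition Ob ::
  "nat \<Rightarrow> (nat \<Rightarrow> ('d::ab_group_add, 'e::ab_group_add) mcochain) \<Rightarrow> ('d, 'e) mcochain" where
  "Ob N \<theta> = (Ob_alg N (FD \<theta>), Ob_alg N (FE \<theta>), Ob_psi N \<theta>)"

end

theory Submission imports Defs begin

text \<open>Extend the truncated products and the truncated map \<open>K[[t]]\<close>-linearly to formal power
  series. The associators of \<open>f\<^sub>D\<close> and \<open>f\<^sub>E\<close> and the defect
  \<open>f\<^sub>E(\<Psi> u, \<Psi> v) - \<Psi>(f\<^sub>D(u, v))\<close> all vanish modulo \<open>t\<^sup>N\<^sup>+\<^sup>1\<close>, and their coefficients at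
  \<open>t\<^sup>N\<^sup>+\<^sup>1\<close>, which depend only on the constant terms of the arguments, are the three components
  of the obstruction. Two identities hold exactly for arbitrary bilinear products: the pentagon
  identity for associators, and the expression of the coboundary of the defect through
  the two associators. In degree \<open>N + 1\<close> they become the cocycle condition, since there every
  outer product is the undeformed one.\<close>

section \<open>Additive maps of power series commuting with multiplication by t\<close>

text \<open>Multiplication by \<open>t\<close>, for coefficients that do not form a ring.\<close>

definition tshift :: "'a::zero fps \<Rightarrow> 'a fps" where
  "tshift u = Abs_fps (\<lambda>n. if n = 0 then 0 else fps_nth u (n - 1))"

lemma tshift_nth: "fps_nth (tshift u) n = (if n = 0 then 0 else fps_nth u (n - 1))"
  by (simp add: tshift_def)

lemma fps_const_plus_tshift:
  fixes u :: "'a::comm_monoid_add fps"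
  shows "u = fps_const (fps_nth u 0) + tshift (fps_shift 1 u)"
  by (rule fps_ext) (auto simp: tshift_nth)

lemma tshift_diff: "tshift (u - v) = tshift u - (tshift v :: 'a::ab_group_add fps)"
  by (rule fps_ext) (auto simp: tshift_nth)

text \<open>Linearity over the integer polynomials in t. It is what the coefficientwise inductions
  use, which split off the constant term and one factor t at a time.\<close>

definition t_linear :: "('a::ab_group_add fps \<Rightarrow> 'b::ab_group_add fps) \<Rightarrow> bool" where
  "t_linear T \<longleftrightarrow> additive T \<and> (\<forall>u. T (tshift u) = tshift (T u))"

lemma t_linear_additive: "t_linear T \<Longrightarrow> additive T"
  by (simp add: t_linear_def)

lemma t_linear_compose:
  "t_linear S \<Longrightarrow> t_linear T \<Longrightarrow> t_linear (\<lambda>u. S (T u))"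
  by (simp add: t_linear_def additive_def)

lemma t_linear_diff:
  "t_linear S \<Longrightarrow> t_linear T \<Longrightarrow> t_linear (\<lambda>u. S u - T u)"
  by (simp add: t_linear_def additive_def tshift_diff)

text \<open>Write u = u0 + t u' with u0 constant; the factor t lowers the degree by one. This is the
  recursion behind the next three lemmas.\<close>

lemma t_linear_nth_Suc:
  assumes "t_linear T"
  shows "fps_nth (T u) (Suc n) =
    fps_nth (T (fps_const (fps_nth u 0))) (Suc n) + fps_nth (T (fps_shift 1 u)) n"
proof -
  have "T u = T (fps_const (fps_nth u 0)) + tshift (T (fps_shift 1 u))"
    using assms fps_const_plus_tshift[of u] by (metis t_linear_def additive.add)
  then show ?thesis
    by (metis add_diff_cancel_left' fps_add_nth nat.distinct(1) plus_1_eq_Suc tshift_nth)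
qed

lemma t_linear_nth_0:
  assumes "t_linear T"
  shows "fps_nth (T u) 0 = fps_nth (T (fps_const (fps_nth u 0))) 0"
proof -
  have "T u = T (fps_const (fps_nth u 0)) + tshift (T (fps_shift 1 u))"
    using assms fps_const_plus_tshift[of u] by (metis t_linear_def additive.add)
  then show ?thesis
    by (metis add.right_neutral fps_add_nth tshift_nth)
qed

text \<open>Carries identities known for elements over to power series with these coefficients, by
  induction along the recursion.\<close>

lemma t_linear_eq_0_if_const:
  assumes "t_linear T" and "\<And>a n. n < m \<Longrightarrow> fps_nth (T (fps_const a)) n = 0"
  shows "n < m \<Longrightarrow> fps_nth (T u) n = 0"
proof (induction n arbitrary: u)
  case 0
  then show ?case using assms by (simp add: t_linear_nth_0[OF assms(1), of u])
next
  case (Suc n)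
  then show ?case using assms by (simp add: t_linear_nth_Suc[OF assms(1), of u])
qed

text \<open>In the recursion the contribution of \<open>fps_shift 1 u\<close> sits in degree
  \<open>m - 1\<close>, where T vanishes. Hence an obstruction is a function of elements, not of
  power series.\<close>

lemma t_linear_nth_eq_const:
  assumes "t_linear T" and "\<And>u n. n < m \<Longrightarrow> fps_nth (T u) n = 0"
  shows "fps_nth (T u) m = fps_nth (T (fps_const (fps_nth u 0))) m"
  using assms t_linear_nth_0[OF assms(1), of u] t_linear_nth_Suc[OF assms(1), of u]
  by (cases m) auto

text \<open>Here w = t^m w' and T w = t^m T w', so the constant term of T w' is asked for, and it
  sees only the constant term of w'.\<close>

lemma t_linear_nth_leading:
  assumes "t_linear T"
  shows "(\<And>n. n < m \<Longrightarrow> fps_nth w n = 0) \<Longrightarrow>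
    fps_nth (T w) m = fps_nth (T (fps_const (fps_nth w m))) 0"
proof (induction m arbitrary: w)
  case 0
  show ?case by (rule t_linear_nth_0[OF assms])
next
  case (Suc m)
  have "fps_nth w 0 = 0" using Suc.prems by simp
  moreover have "T 0 = 0" using assms additive.zero t_linear_additive by blast
  ultimately have "fps_nth (T w) (Suc m) = fps_nth (T (fps_shift 1 w)) m"
    by (simp add: t_linear_nth_Suc[OF assms, of w])
  also have "\<dots> = fps_nth (T (fps_const (fps_nth w (Suc m)))) 0"
    using Suc.IH[of "fps_shift 1 w"] Suc.prems by simp
  finally show ?case .
qed

section \<open>The truncated product on power series\<close>

definition biadditive :: "('a::ab_group_add \<Rightarrow> 'b::ab_group_add \<Rightarrow> 'c::ab_group_add) \<Rightarrow> bool" where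
  "biadditive h \<longleftrightarrow> (\<forall>a. additive (h a)) \<and> (\<forall>b. additive (\<lambda>a. h a b))"

lemma biadditive_simps:
  assumes "biadditive h"
  shows "h (a + a') b = h a b + h a' b" "h a (b + b') = h a b + h a b'"
    "h (a - a') b = h a b - h a' b" "h a (b - b') = h a b - h a b'"
    "h 0 b = 0" "h a 0 = 0"
proof -
  interpret l: additive "\<lambda>a. h a b" for b using assms by (simp add: biadditive_def)
  interpret r: additive "h a" for a using assms by (simp add: biadditive_def)
  show "h (a + a') b = h a b + h a' b" "h a (b + b') = h a b + h a b'"
    "h (a - a') b = h a b - h a' b" "h a (b - b') = h a b - h a b'"
    "h 0 b = 0" "h a 0 = 0"
    by (rule l.add r.add l.diff r.diff l.zero r.zero)+
qed

lemma finite_triples: "finite {(i, j, k). (i::nat) \<le> N \<and> i + j + k = n}"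
  by (rule finite_subset[of _ "{..n} \<times> {..n} \<times> {..n}"]) auto

lemma finite_pairs: "finite {(i, j). (i::nat) \<le> N \<and> i + j = n}"
  by (rule finite_subset[of _ "{..n} \<times> {..n}"]) auto

lemma tprod_nth:
  "fps_nth (tprod N F s u v) n = (\<Sum>(i, j, k)\<in>{(i, j, k). i \<le> N \<and> i + j + k = n}.
       bil (F i) s (fps_nth u j) (fps_nth v k))"
  by (simp add: tprod_def)

lemma t_linear_tprod_left:
  assumes "\<And>i. i \<le> N \<Longrightarrow> biadditive (bil (F i) s)"
  shows "t_linear (\<lambda>u. tprod N F s u v)"
  unfolding t_linear_def
proof (intro conjI allI)
  show "additive (\<lambda>u. tprod N F s u v)"
    by (rule additive.intro, rule fps_ext, simp add: tprod_nth sum.distrib[symmetric],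
        rule sum.cong) (auto simp: assms biadditive_simps)
  fix u
  show "tprod N F s (tshift u) v = tshift (tprod N F s u v)"
  proof (rule fps_ext)
    fix n
    show "fps_nth (tprod N F s (tshift u) v) n = fps_nth (tshift (tprod N F s u v)) n"
    proof (cases n)
      case 0
      then show ?thesis
        by (simp add: tprod_nth tshift_nth case_prod_beta)
          (auto intro!: sum.neutral simp: assms biadditive_simps)
    next
      case (Suc m)
      let ?g = "\<lambda>(i, j, k). bil (F i) s (fps_nth (tshift u) j) (fps_nth v k)"
      \<comment> \<open>The terms with \<open>j = 0\<close> vanish because \<open>tshift u\<close>
        has no constant term; the others are the terms of degree \<open>m\<close> with
        \<open>j\<close> raised by one.\<close>
      have "sum ?g {(i, j, k). i \<le> N \<and> i + j + k = n}
        = sum ?g ((\<lambda>(i, j, k). (i, Suc j, k)) ` {(i, j, k). i \<le> N \<and> i + j + k = m})"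
      proof (rule sum.mono_neutral_right[OF finite_triples], goal_cases)
        case 2
        have "j = 0" if "i \<le> N" "i + j + k = n"
            "(i, j, k) \<notin> (\<lambda>(i, j, k). (i, Suc j, k)) ` {(i, j, k). i \<le> N \<and> i + j + k = m}" for i j k
          using that Suc by (cases j) (auto simp: image_iff)
        then show ?case by (auto simp: tshift_nth assms biadditive_simps)
      qed (use Suc in auto)
      also have "\<dots> = fps_nth (tprod N F s u v) m"
        by (subst sum.reindex) (auto simp: inj_on_def tprod_nth tshift_nth intro!: sum.cong)
      finally show ?thesis by (simp add: tprod_nth Suc tshift_nth)
    qed
  qed
qed

lemma t_linear_tprod_right:
  assumes "\<And>i. i \<le> N \<Longrightarrow> biadditive (bil (F i) s)"
  shows "t_linear (tprod N F s u)"
  unfolding t_linear_def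
proof (intro conjI allI)
  show "additive (tprod N F s u)"
    by (rule additive.intro, rule fps_ext, simp add: tprod_nth sum.distrib[symmetric],
        rule sum.cong) (auto simp: assms biadditive_simps)
  fix v
  show "tprod N F s u (tshift v) = tshift (tprod N F s u v)"
  proof (rule fps_ext)
    fix n
    show "fps_nth (tprod N F s u (tshift v)) n = fps_nth (tshift (tprod N F s u v)) n"
    proof (cases n)
      case 0
      then show ?thesis
        by (simp add: tprod_nth tshift_nth case_prod_beta)
          (auto intro!: sum.neutral simp: assms biadditive_simps)
    next
      case (Suc m)
      let ?g = "\<lambda>(i, j, k). bil (F i) s (fps_nth u j) (fps_nth (tshift v) k)"
      have "sum ?g {(i, j, k). i \<le> N \<and> i + j + k = n}
        = sum ?g ((\<lambda>(i, j, k). (i, j, Suc k)) ` {(i, j, k). i \<le> N \<and> i + j + k = m})"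
      proof (rule sum.mono_neutral_right[OF finite_triples], goal_cases)
        case 2
        have "k = 0" if "i \<le> N" "i + j + k = n"
            "(i, j, k) \<notin> (\<lambda>(i, j, k). (i, j, Suc k)) ` {(i, j, k). i \<le> N \<and> i + j + k = m}" for i j k
          using that Suc by (cases k) (auto simp: image_iff)
        then show ?case by (auto simp: tshift_nth assms biadditive_simps)
      qed (use Suc in auto)
      also have "\<dots> = fps_nth (tprod N F s u v) m"
        by (subst sum.reindex) (auto simp: inj_on_def tprod_nth tshift_nth intro!: sum.cong)
      finally show ?thesis by (simp add: tprod_nth Suc tshift_nth)
    qed
  qed
qed

lemma tprod_nth_0: "fps_nth (tprod N F s u v) 0 = bil (F 0) s (fps_nth u 0) (fps_nth v 0)"
proof -
  have "{(i, j, k). i \<le> N \<and> i + j + k = 0} = {(0, 0, 0::nat)}" by auto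
  then show ?thesis by (simp add: tprod_nth del: add_is_0)
qed

lemma tprod_const_right_nth:
  assumes "\<And>i. i \<le> N \<Longrightarrow> biadditive (bil (F i) s)"
  shows "fps_nth (tprod N F s u (fps_const b)) n =
    (\<Sum>(i, j)\<in>{(i, j). i \<le> N \<and> i + j = n}. bil (F i) s (fps_nth u j) b)"
proof -
  have "fps_nth (tprod N F s u (fps_const b)) n =
    (\<Sum>(i, j, k)\<in>(\<lambda>(i, j). (i, j, 0)) ` {(i, j). i \<le> N \<and> i + j = n}.
       bil (F i) s (fps_nth u j) (fps_nth (fps_const b) k))"
    unfolding tprod_nth
    by (rule sum.mono_neutral_right[OF finite_triples])
      (auto simp: assms biadditive_simps image_iff)
  also have "\<dots> = (\<Sum>(i, j)\<in>{(i, j). i \<le> N \<and> i + j = n}. bil (F i) s (fps_nth u j) b)"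
    by (subst sum.reindex) (auto simp: inj_on_def intro!: sum.cong)
  finally show ?thesis .
qed

lemma tprod_const_left_nth:
  assumes "\<And>i. i \<le> N \<Longrightarrow> biadditive (bil (F i) s)"
  shows "fps_nth (tprod N F s (fps_const a) v) n =
    (\<Sum>(i, j)\<in>{(i, j). i \<le> N \<and> i + j = n}. bil (F i) s a (fps_nth v j))"
proof -
  have "fps_nth (tprod N F s (fps_const a) v) n =
    (\<Sum>(i, j, k)\<in>(\<lambda>(i, j). (i, 0, j)) ` {(i, j). i \<le> N \<and> i + j = n}.
       bil (F i) s (fps_nth (fps_const a) j) (fps_nth v k))"
    unfolding tprod_nth
    by (rule sum.mono_neutral_right[OF finite_triples])
      (auto simp: assms biadditive_simps image_iff)
  also have "\<dots> = (\<Sum>(i, j)\<in>{(i, j). i \<le> N \<and> i + j = n}. bil (F i) s a (fps_nth v j))"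
    by (subst sum.reindex) (auto simp: inj_on_def intro!: sum.cong)
  finally show ?thesis .
qed

text \<open>Two constants leave only \<open>i = n\<close>. The value 0 beyond \<open>N\<close> is
  what later confines the sums in degree \<open>N + 1\<close> to the index sets of the
  obstruction.\<close>

lemma tprod_const_const_nth:
  assumes "\<And>i. i \<le> N \<Longrightarrow> biadditive (bil (F i) s)"
  shows "fps_nth (tprod N F s (fps_const a) (fps_const b)) n = (if n \<le> N then bil (F n) s a b else 0)"
proof -
  have "fps_nth (tprod N F s (fps_const a) (fps_const b)) n =
    (\<Sum>(i, j)\<in>(if n \<le> N then {(n, 0::nat)} else {}). bil (F i) s (fps_nth (fps_const a) j) b)"
    unfolding tprod_const_right_nth[of N F, OF assms, simplified]
    by (rule sum.mono_neutral_right[OF finite_pairs])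
      (auto simp: assms biadditive_simps split: if_splits)
  then show ?thesis by auto
qed

section \<open>The truncated linear map on power series\<close>

definition tmap :: "nat \<Rightarrow> (nat \<Rightarrow> 'd \<Rightarrow> 'e) \<Rightarrow> 'd::ab_group_add fps \<Rightarrow> 'e::ab_group_add fps" where
  "tmap N p u = Abs_fps (\<lambda>n. \<Sum>(i, j)\<in>{(i, j). i \<le> N \<and> i + j = n}. p i (fps_nth u j))"

lemma tmap_nth:
  "fps_nth (tmap N p u) n = (\<Sum>(i, j)\<in>{(i, j). i \<le> N \<and> i + j = n}. p i (fps_nth u j))"
  by (simp add: tmap_def)

lemma t_linear_tmap:
  assumes "\<And>i. i \<le> N \<Longrightarrow> additive (p i)"
  shows "t_linear (tmap N p)"
  unfolding t_linear_def
proof (intro conjI allI)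
  show "additive (tmap N p)"
    by (rule additive.intro, rule fps_ext, simp add: tmap_nth sum.distrib[symmetric],
        rule sum.cong) (auto simp: assms additive.add)
  fix u :: "'a fps"
  show "tmap N p (tshift u) = tshift (tmap N p u)"
  proof (rule fps_ext)
    fix n
    show "fps_nth (tmap N p (tshift u)) n = fps_nth (tshift (tmap N p u)) n"
    proof (cases n)
      case 0
      then show ?thesis
        by (simp add: tmap_nth tshift_nth case_prod_beta)
          (auto intro!: sum.neutral simp: assms additive.zero)
    next
      case (Suc m)
      let ?g = "\<lambda>(i, j). p i (fps_nth (tshift u) j)"
      have "sum ?g {(i, j). i \<le> N \<and> i + j = n}
        = sum ?g ((\<lambda>(i, j). (i, Suc j)) ` {(i, j). i \<le> N \<and> i + j = m})"
      proof (rule sum.mono_neutral_right[OF finite_pairs], goal_cases)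
        case 2
        have "j = 0" if "i \<le> N" "i + j = n"
            "(i, j) \<notin> (\<lambda>(i, j). (i, Suc j)) ` {(i, j). i \<le> N \<and> i + j = m}" for i j
          using that Suc by (cases j) (auto simp: image_iff)
        then show ?case by (auto simp: tshift_nth assms additive.zero)
      qed (use Suc in auto)
      also have "\<dots> = fps_nth (tmap N p u) m"
        by (subst sum.reindex) (auto simp: inj_on_def tmap_nth tshift_nth intro!: sum.cong)
      finally show ?thesis by (simp add: tmap_nth Suc tshift_nth)
    qed
  qed
qed

lemma tmap_nth_0: "fps_nth (tmap N p u) 0 = p 0 (fps_nth u 0)"
proof -
  have "{(i, j). i \<le> N \<and> i + j = 0} = {(0, 0::nat)}" by auto
  then show ?thesis by (simp add: tmap_nth del: add_is_0)
qed

lemma tmap_const_nth: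
  assumes "\<And>i. i \<le> N \<Longrightarrow> additive (p i)"
  shows "fps_nth (tmap N p (fps_const a)) n = (if n \<le> N then p n a else 0)"
proof -
  have "fps_nth (tmap N p (fps_const a)) n =
    (\<Sum>(i, j)\<in>(if n \<le> N then {(n, 0::nat)} else {}). p i (fps_nth (fps_const a) j))"
    unfolding tmap_nth
    by (rule sum.mono_neutral_right[OF finite_pairs])
      (auto simp: assms additive.zero split: if_splits)
  then show ?thesis by auto
qed

section \<open>Enumeration of the small trees and the operations at their leaves\<close>

lemma ntrees_0: "ntrees 0 = {Leaf}"
proof -
  have "leaves y > 0" for y by (induction y) auto
  then have "leaves y = 1 \<longleftrightarrow> y = Leaf" for y
    by (cases y) (auto, metis add_is_1 less_numeral_extra(3))
  then show ?thesis by (auto simp: ntrees_def)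
qed

text \<open>A tree other than \<open>Leaf\<close> is a grafting, and its leaves are shared out
  between the two subtrees. Iterating this recursion lists the trees.\<close>

lemma ntrees_Suc:
  "ntrees (Suc n) = (\<Union>i\<le>n. (\<lambda>(l, r). Graft l r) ` (ntrees i \<times> ntrees (n - i)))"
proof (rule set_eqI)
  have pos: "leaves y > 0" for y by (induction y) auto
  fix y
  show "y \<in> ntrees (Suc n) \<longleftrightarrow> y \<in> (\<Union>i\<le>n. (\<lambda>(l, r). Graft l r) ` (ntrees i \<times> ntrees (n - i)))"
  proof (cases y)
    case (Graft l r)
    have "leaves l + leaves r = Suc (Suc n) \<longleftrightarrow>
      (\<exists>i\<le>n. leaves l = Suc i \<and> leaves r = Suc (n - i))"
    proof
      assume "leaves l + leaves r = Suc (Suc n)"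
      \<comment> \<open>Both subtrees have a leaf, so the subtraction in the witness is exact and
        the witness is at most \<open>n\<close>.\<close>
      then show "\<exists>i\<le>n. leaves l = Suc i \<and> leaves r = Suc (n - i)"
        using pos[of l] pos[of r] by (intro exI[of _ "leaves l - 1"]) auto
    qed auto
    then show ?thesis using Graft by (auto simp: ntrees_def image_iff)
  qed (auto simp: ntrees_def)
qed

lemma ntrees_1: "ntrees 1 = {tree1}"
  by (simp add: ntrees_Suc ntrees_0 tree1_def)

lemma ntrees_2: "ntrees 2 = {tree21, tree12}"
  using ntrees_Suc[of 1] ntrees_1
  by (simp add: atMost_Suc ntrees_0 tree21_def tree12_def numeral_2_eq_2)

lemma ntrees_3: "ntrees 3 = {tree321, tree312, tree131, tree213, tree123}"
  using ntrees_Suc[of 2] ntrees_1 ntrees_2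
  by (simp add: atMost_Suc ntrees_0 numeral_3_eq_3 numeral_2_eq_2
      tree321_def tree312_def tree131_def tree213_def tree123_def)

text \<open>The Catalan number 14, split by the size of the left subtree as 5 + 2 + 2 + 5.\<close>

lemma ntrees_4: "ntrees 4 =
  {Graft Leaf tree321, Graft Leaf tree312, Graft Leaf tree131, Graft Leaf tree213, Graft Leaf tree123,
   Graft tree1 tree21, Graft tree1 tree12, Graft tree21 tree1, Graft tree12 tree1,
   Graft tree321 Leaf, Graft tree312 Leaf, Graft tree131 Leaf, Graft tree213 Leaf, Graft tree123 Leaf}"
  using ntrees_Suc[of 3] ntrees_1 ntrees_2 ntrees_3
  by (simp add: atMost_Suc ntrees_0 numeral_3_eq_3 numeral_2_eq_2 eval_nat_numeral)

lemmas tree_defs = tree321_def tree312_def tree131_def tree213_def tree123_def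
  tree21_def tree12_def tree1_def

lemma del_leaf_in_ntrees_3:
  assumes "y \<in> ntrees 4" and "i \<le> 4"
  shows "del_leaf i y \<in> ntrees 3"
proof -
  have "\<forall>i\<in>{0, 1, 2, 3, 4}. del_leaf i y \<in> ntrees 3"
    using assms(1) unfolding ntrees_4
    by (elim insertE emptyE; simp add: tree_defs ntrees_def)
  moreover have "i \<in> {0, 1, 2, 3, 4}"
    using assms(2) by auto
  ultimately show ?thesis by blast
qed

text \<open>These relations make the ten terms of the coboundary of the associator at a 4-tree
  cancel in pairs.\<close>

lemma leaf_op_del_leaf:
  assumes "y \<in> ntrees 4"
  shows "leaf_op 2 (del_leaf 0 y) 3 = leaf_op 2 (del_leaf 2 y) 2"
    and "leaf_op 2 (del_leaf 0 y) 1 = leaf_op 3 y 2"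
    and "leaf_op 2 (del_leaf 2 y) 0 = leaf_op 3 y 0"
    and "leaf_op 2 (del_leaf 0 y) 0 = leaf_op 2 (del_leaf 3 y) 2"
    and "leaf_op 2 (del_leaf 0 y) 2 = leaf_op 3 y 3"
    and "leaf_op 2 (del_leaf 3 y) 0 = leaf_op 3 y 0"
    and "leaf_op 2 (del_leaf 1 y) 3 = leaf_op 3 y 4"
    and "leaf_op 2 (del_leaf 1 y) 1 = leaf_op 2 (del_leaf 4 y) 3"
    and "leaf_op 2 (del_leaf 4 y) 1 = leaf_op 3 y 1"
    and "leaf_op 2 (del_leaf 1 y) 0 = leaf_op 2 (del_leaf 3 y) 3"
    and "leaf_op 2 (del_leaf 1 y) 2 = leaf_op 3 y 3"
    and "leaf_op 2 (del_leaf 3 y) 1 = leaf_op 3 y 1"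
    and "leaf_op 2 (del_leaf 2 y) 3 = leaf_op 3 y 4"
    and "leaf_op 2 (del_leaf 2 y) 1 = leaf_op 2 (del_leaf 4 y) 0"
    and "leaf_op 2 (del_leaf 4 y) 2 = leaf_op 3 y 2"
  using assms unfolding ntrees_4
  by (elim insertE emptyE; simp add: tree_defs leaf_op_def)+

section \<open>Pre-Lie products, obstructions and coboundaries on the small trees\<close>

text \<open>The five cases obey one rule: leaves 1 and 3 give the inner and outer operation of
  (ab)c, leaves 2 and 0 those of a(bc). With it, later arguments treat all trees at once.\<close>

lemma prelie_eq:
  assumes "y \<in> ntrees 3"
  shows "prelie F G y [a, b, c] =
    bil F (leaf_op 2 y 3) (bil G (leaf_op 2 y 1) a b) c -
    bil F (leaf_op 2 y 0) a (bil G (leaf_op 2 y 2) b c)"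
  using assms unfolding ntrees_3
  by (elim insertE emptyE; simp add: tree_defs leaf_op_def prelie_def Let_def)

lemma prelie_eq_0:
  assumes "y \<notin> ntrees 3 \<or> length as \<noteq> 3"
  shows "prelie F G y as = 0"
proof (cases "y \<in> ntrees 3")
  case True
  then have "length as \<noteq> 3" using assms by simp
  then show ?thesis by (auto simp: prelie_def split: list.split)
next
  case False
  then show ?thesis unfolding ntrees_3 by (simp add: prelie_def split: list.split)
qed

lemma Ob_alg_eq_0: "y \<notin> ntrees 3 \<or> length as \<noteq> 3 \<Longrightarrow> Ob_alg N F y as = 0"
  by (simp add: Ob_alg_def prelie_eq_0 case_prod_beta)

text \<open>Deleting a leaf of a 3-tree leaves \<open>tree21\<close> or \<open>tree12\<close>, which
  stand for the two operations. Which of them remains is read off at another leaf of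
  \<open>y\<close>: 0 and 2 are exchanged, and so are 1 and 3.\<close>

lemma Ob_psi_del_leaf:
  assumes "y \<in> ntrees 3"
  shows "Ob_psi N \<theta> (del_leaf 0 y) [a, b] = Ob_psi_bil N \<theta> (leaf_op 2 y 2) a b"
    and "Ob_psi N \<theta> (del_leaf 1 y) [a, b] = Ob_psi_bil N \<theta> (leaf_op 2 y 3) a b"
    and "Ob_psi N \<theta> (del_leaf 2 y) [a, b] = Ob_psi_bil N \<theta> (leaf_op 2 y 0) a b"
    and "Ob_psi N \<theta> (del_leaf 3 y) [a, b] = Ob_psi_bil N \<theta> (leaf_op 2 y 1) a b"
  using assms unfolding ntrees_3
  by (elim insertE emptyE; simp add: tree_defs leaf_op_def Ob_psi_def)+

lemma cobd_2:
  assumes "y \<in> ntrees 3"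
  shows "cobd mD lact ract 2 f y [a, b, c] =
    lact (leaf_op 2 y 0) a (f (del_leaf 0 y) [b, c])
    - f (del_leaf 1 y) [mD (leaf_op 2 y 1) a b, c]
    + f (del_leaf 2 y) [a, mD (leaf_op 2 y 2) b c]
    - ract (leaf_op 2 y 3) (f (del_leaf 3 y) [a, b]) c"
proof -
  have "{0..3} = {0, 1, 2, 3 :: nat}" by auto
  then show ?thesis using assms by (simp add: cobd_def coface_def Let_def)
qed

lemma cobd_3:
  assumes "y \<in> ntrees 4"
  shows "cobd mD lact ract 3 f y [a, b, c, d] =
    lact (leaf_op 3 y 0) a (f (del_leaf 0 y) [b, c, d])
    - f (del_leaf 1 y) [mD (leaf_op 3 y 1) a b, c, d]
    + f (del_leaf 2 y) [a, mD (leaf_op 3 y 2) b c, d]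
    - f (del_leaf 3 y) [a, b, mD (leaf_op 3 y 3) c d]
    + ract (leaf_op 3 y 4) (f (del_leaf 4 y) [a, b, c]) d"
proof -
  have "{0..4} = {0, 1, 2, 3, 4 :: nat}" by auto
  then show ?thesis using assms by (simp add: cobd_def coface_def Let_def)
qed

section \<open>Associators of a truncated dialgebra, for both source and target\<close>

locale truncated_dialgebra =
  fixes N :: nat and F :: "nat \<Rightarrow> ('d::ab_group_add, 'd) cochain"
  assumes biadd: "i \<le> N \<Longrightarrow> biadditive (bil (F i) s)"
    and tprod_identities: "dialgebra_identities (eq_mod_t (N + 1))
      (tprod N F) (tprod N F) (tprod N F) (tprod N F)"
begin

definition tassoc :: "ptree \<Rightarrow> 'd fps \<Rightarrow> 'd fps \<Rightarrow> 'd fps \<Rightarrow> 'd fps" where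
  "tassoc y u v w =
    tprod N F (leaf_op 2 y 3) (tprod N F (leaf_op 2 y 1) u v) w -
    tprod N F (leaf_op 2 y 0) u (tprod N F (leaf_op 2 y 2) v w)"

lemma tprod_t_linear_left: "t_linear (\<lambda>u. tprod N F s u v)"
  by (rule t_linear_tprod_left) (rule biadd)

lemma tprod_t_linear_right: "t_linear (tprod N F s u)"
  by (rule t_linear_tprod_right) (rule biadd)

lemma tassoc_t_linear:
  "t_linear (\<lambda>u. tassoc y u v w)" "t_linear (\<lambda>v. tassoc y u v w)" "t_linear (tassoc y u v)"
  unfolding tassoc_def
  by (intro t_linear_diff tprod_t_linear_left tprod_t_linear_right t_linear_compose[OF tprod_t_linear_left] t_linear_compose[OF tprod_t_linear_right])+

lemma tprod_diff:
  "tprod N F s (u - u') v = tprod N F s u v - tprod N F s u' v"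
  "tprod N F s u (v - v') = tprod N F s u v - tprod N F s u v'"
  using additive.diff[OF t_linear_additive[OF tprod_t_linear_left]] additive.diff[OF t_linear_additive[OF tprod_t_linear_right]]
  by blast+

text \<open>The five 3-trees, in the order of \<open>ntrees_3\<close>, correspond to the five
  dialgebra axioms in their order, which hold modulo t^(N+1).\<close>

lemma tassoc_nth_eq_0:
  assumes "y \<in> ntrees 3" and "n < N + 1"
  shows "fps_nth (tassoc y u v w) n = 0"
  using assms(1) tprod_identities assms(2) unfolding ntrees_3
  by (elim insertE emptyE;
      simp add: tree_defs leaf_op_def tassoc_def dialgebra_identities_def eq_mod_t_def)

lemma tassoc_const_nth:
  assumes "y \<in> ntrees 3"
  shows "fps_nth (tassoc y (fps_const a) (fps_const b) (fps_const c)) (N + 1) =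
    Ob_alg N F y [a, b, c]"
proof -
  let ?I = "{(i, j). i + j = N + 1 \<and> i > 0 \<and> j > 0}"
  \<comment> \<open>In degree \<open>N + 1\<close>, truncating the inner product removes
    \<open>i = 0\<close>, where \<open>j = N + 1\<close>, and truncating the outer one removes
    \<open>j = 0\<close>. The pairs of \<open>Ob_alg\<close> remain.\<close>
  have trunc: "(\<Sum>(i, j)\<in>{(i, j). i \<le> N \<and> i + j = N + 1}. g i (if j \<le> N then h j else 0))
    = (\<Sum>(i, j)\<in>?I. g i (h j))" if "\<And>i. i \<le> N \<Longrightarrow> g i 0 = 0" for g :: "nat \<Rightarrow> 'd \<Rightarrow> 'd" and h
  proof -
    have "(\<Sum>(i, j)\<in>{(i, j). i \<le> N \<and> i + j = N + 1}. g i (if j \<le> N then h j else 0))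
      = (\<Sum>(i, j)\<in>?I. g i (if j \<le> N then h j else 0))"
      by (rule sum.mono_neutral_right[OF finite_pairs]) (auto simp: that intro!: gr0I)
    also have "\<dots> = (\<Sum>(i, j)\<in>?I. g i (h j))"
      by (rule sum.cong) auto
    finally show ?thesis .
  qed
  have "fps_nth (tprod N F s (tprod N F s' (fps_const a) (fps_const b)) (fps_const c)) (N + 1)
    = (\<Sum>(i, j)\<in>?I. bil (F i) s (bil (F j) s' a b) c)" for s s'
    using trunc[of "\<lambda>i x. bil (F i) s x c" "\<lambda>j. bil (F j) s' a b"]
    by (simp add: tprod_const_right_nth[of N F s "tprod N F s' u v" for u v]
        tprod_const_const_nth biadd biadditive_simps)
  moreover have "fps_nth (tprod N F s (fps_const a) (tprod N F s' (fps_const b) (fps_const c))) (N + 1)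
    = (\<Sum>(i, j)\<in>?I. bil (F i) s a (bil (F j) s' b c))" for s s'
    using trunc[of "\<lambda>i x. bil (F i) s a x" "\<lambda>j. bil (F j) s' b c"]
    by (simp add: tprod_const_left_nth[of N F s _ "tprod N F s' u v" for u v]
        tprod_const_const_nth biadd biadditive_simps)
  ultimately show ?thesis
    by (simp add: tassoc_def Ob_alg_def prelie_eq[OF assms] case_prod_beta sum_subtractf)
qed

text \<open>The associator vanishes below degree \<open>N + 1\<close>, so its arguments may be
  replaced by their constant terms one after the other.\<close>

lemma tassoc_nth:
  assumes "y \<in> ntrees 3"
  shows "fps_nth (tassoc y u v w) (N + 1) = Ob_alg N F y [fps_nth u 0, fps_nth v 0, fps_nth w 0]"
proof -
  have "fps_nth (tassoc y u v w) (N + 1) = fps_nth (tassoc y (fps_const (fps_nth u 0)) v w) (N + 1)"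
    by (rule t_linear_nth_eq_const[OF tassoc_t_linear(1) tassoc_nth_eq_0[OF assms]])
  also have "\<dots> = fps_nth (tassoc y (fps_const (fps_nth u 0)) (fps_const (fps_nth v 0)) w) (N + 1)"
    by (rule t_linear_nth_eq_const[OF tassoc_t_linear(2) tassoc_nth_eq_0[OF assms]])
  also have "\<dots> = fps_nth (tassoc y (fps_const (fps_nth u 0)) (fps_const (fps_nth v 0))
      (fps_const (fps_nth w 0))) (N + 1)"
    by (rule t_linear_nth_eq_const[OF tassoc_t_linear(3) tassoc_nth_eq_0[OF assms]])
  finally show ?thesis by (simp only: tassoc_const_nth[OF assms])
qed

text \<open>If t^m divides one factor, then in degree m its leading coefficient meets only the
  constant term of the other factor and the undeformed product \<open>F 0\<close>.\<close>

lemma tprod_nth_leading: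
  "(\<And>n. n < m \<Longrightarrow> fps_nth w n = 0) \<Longrightarrow>
    fps_nth (tprod N F s u w) m = bil (F 0) s (fps_nth u 0) (fps_nth w m)"
  "(\<And>n. n < m \<Longrightarrow> fps_nth u n = 0) \<Longrightarrow>
    fps_nth (tprod N F s u w) m = bil (F 0) s (fps_nth u m) (fps_nth w 0)"
  using t_linear_nth_leading[OF tprod_t_linear_right, of m w s u] t_linear_nth_leading[OF tprod_t_linear_left, of m u s w]
  by (simp_all add: tprod_nth_0)

text \<open>Expanding the associators yields each of the five bracketings of four factors twice,
  with opposite signs; \<open>leaf_op_del_leaf\<close> makes the operations of the two copies
  agree.\<close>

lemma tassoc_pentagon:
  assumes "y \<in> ntrees 4"
  shows "tprod N F (leaf_op 3 y 0) a (tassoc (del_leaf 0 y) b c d)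
    - tassoc (del_leaf 1 y) (tprod N F (leaf_op 3 y 1) a b) c d
    + tassoc (del_leaf 2 y) a (tprod N F (leaf_op 3 y 2) b c) d
    - tassoc (del_leaf 3 y) a b (tprod N F (leaf_op 3 y 3) c d)
    + tprod N F (leaf_op 3 y 4) (tassoc (del_leaf 4 y) a b c) d = 0"
  unfolding tassoc_def tprod_diff leaf_op_del_leaf[OF assms] by simp

lemma cobd_Ob_alg: "cobd (bil (F 0)) (bil (F 0)) (bil (F 0)) 3 (Ob_alg N F) = (\<lambda>y as. 0)"
proof (intro ext)
  fix y as
  show "cobd (bil (F 0)) (bil (F 0)) (bil (F 0)) 3 (Ob_alg N F) y as = 0"
  proof (cases "y \<in> ntrees 4 \<and> length as = 4")
    case True
    then obtain a b c d where as: "as = [a, b, c, d]"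
      by (auto simp: eval_nat_numeral length_Suc_conv)
    have y: "y \<in> ntrees 4" using True by blast
    \<comment> \<open>Compare coefficients of t^(N+1) in the pentagon at constants. The outer
      products become \<open>bil (F 0)\<close> by \<open>tprod_nth_leading\<close>; products inside
      an associator enter only through their constant terms, again given by
      \<open>bil (F 0)\<close>. This gives the five terms of \<open>cobd_3\<close>.\<close>
    show ?thesis
      using arg_cong[OF tassoc_pentagon[OF y, of "fps_const a" "fps_const b" "fps_const c" "fps_const d"],
          of "\<lambda>u. fps_nth u (N + 1)"]
      by (simp only: as cobd_3[OF y] fps_add_nth fps_sub_nth fps_zero_nth)
        (simp add: tassoc_nth[simplified] tprod_nth_leading tassoc_nth_eq_0 del_leaf_in_ntrees_3[OF y]
          tprod_nth_0)
  qed (auto simp: cobd_def)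
qed

end

section \<open>The defect of the truncated morphism\<close>

locale truncated_dialgebra_morphism =
  D: truncated_dialgebra N "FD \<theta>" + E: truncated_dialgebra N "FE \<theta>"
  for N :: nat and \<theta> :: "nat \<Rightarrow> ('d::ab_group_add, 'e::ab_group_add) mcochain" +
  assumes additive_psi: "i \<le> N \<Longrightarrow> additive (psi \<theta> i)"
    and hom: "n \<le> N \<Longrightarrow> (\<Sum>i=0..n. psi \<theta> i (bil (FD \<theta> (n - i)) s a b)) =
        (\<Sum>(i, j, k)\<in>{(i, j, k). i + j + k = n}. bil (FE \<theta> i) s (psi \<theta> j a) (psi \<theta> k b))"
begin

abbreviation "\<mu> \<equiv> tprod N (FD \<theta>)"
abbreviation "\<nu> \<equiv> tprod N (FE \<theta>)"
abbreviation "\<Psi> \<equiv> tmap N (psi \<theta>)"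

lemma \<Psi>_t_linear: "t_linear \<Psi>"
  by (rule t_linear_tmap) (rule additive_psi)

lemma \<Psi>_diff: "\<Psi> (u - v) = \<Psi> u - \<Psi> v"
  using additive.diff[OF t_linear_additive[OF \<Psi>_t_linear]] .

definition defect :: "dop \<Rightarrow> 'd fps \<Rightarrow> 'd fps \<Rightarrow> 'e fps" where
  "defect s u v = \<nu> s (\<Psi> u) (\<Psi> v) - \<Psi> (\<mu> s u v)"

lemma defect_t_linear: "t_linear (\<lambda>u. defect s u v)" "t_linear (defect s u)"
  unfolding defect_def
  by (intro t_linear_diff t_linear_compose[OF \<Psi>_t_linear] D.tprod_t_linear_left D.tprod_t_linear_right
      t_linear_compose[OF E.tprod_t_linear_left] t_linear_compose[OF E.tprod_t_linear_right] \<Psi>_t_linear)+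

text \<open>Stated for every degree to serve twice: for \<open>n \<le> N\<close> the truncation
  bounds are automatic and the homomorphism condition appears, for \<open>n = N + 1\<close> they are
  the bounds of \<open>Ob_psi_bil\<close>.\<close>

lemma defect_const_nth:
  "fps_nth (defect s (fps_const a) (fps_const b)) n =
    (\<Sum>(i, j, k)\<in>{(i, j, k). i \<le> N \<and> j \<le> N \<and> k \<le> N \<and> i + j + k = n}.
        bil (FE \<theta> i) s (psi \<theta> j a) (psi \<theta> k b))
     - (\<Sum>i\<in>{i. i \<le> N \<and> i \<le> n \<and> n - i \<le> N}. psi \<theta> i (bil (FD \<theta> (n - i)) s a b))"
proof -
  have "fps_nth (\<nu> s (\<Psi> (fps_const a)) (\<Psi> (fps_const b))) n =
    (\<Sum>(i, j, k)\<in>{(i, j, k). i \<le> N \<and> j \<le> N \<and> k \<le> N \<and> i + j + k = n}.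
        bil (FE \<theta> i) s (fps_nth (\<Psi> (fps_const a)) j) (fps_nth (\<Psi> (fps_const b)) k))"
    unfolding tprod_nth
    by (rule sum.mono_neutral_right[OF finite_triples])
      (auto simp: tmap_const_nth additive_psi E.biadd biadditive_simps split: if_splits)
  also have "\<dots> = (\<Sum>(i, j, k)\<in>{(i, j, k). i \<le> N \<and> j \<le> N \<and> k \<le> N \<and> i + j + k = n}.
        bil (FE \<theta> i) s (psi \<theta> j a) (psi \<theta> k b))"
    by (rule sum.cong) (auto simp: tmap_const_nth additive_psi)
  finally have 1: "fps_nth (\<nu> s (\<Psi> (fps_const a)) (\<Psi> (fps_const b))) n = \<dots>" .
  \<comment> \<open>Pairs with \<open>i + j = n\<close> are indexed by \<open>i\<close>: the bound
    \<open>i \<le> n\<close> keeps \<open>n - i\<close> exact, and \<open>n - i \<le> N\<close>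
    reflects the truncation of \<open>\<mu>\<close>.\<close>
  have "fps_nth (\<Psi> (\<mu> s (fps_const a) (fps_const b))) n =
    (\<Sum>(i, j)\<in>(\<lambda>i. (i, n - i)) ` {i. i \<le> N \<and> i \<le> n \<and> n - i \<le> N}.
      psi \<theta> i (fps_nth (\<mu> s (fps_const a) (fps_const b)) j))"
    unfolding tmap_nth
    by (rule sum.mono_neutral_right[OF finite_pairs])
      (auto simp: tprod_const_const_nth D.biadd additive_psi additive.zero image_iff)
  also have "\<dots> = (\<Sum>i\<in>{i. i \<le> N \<and> i \<le> n \<and> n - i \<le> N}. psi \<theta> i (bil (FD \<theta> (n - i)) s a b))"
    by (subst sum.reindex) (auto simp: inj_on_def tprod_const_const_nth D.biadd intro!: sum.cong)
  finally show ?thesis unfolding defect_def fps_sub_nth 1 by simp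
qed

text \<open>The homomorphism condition concerns elements, that is, constant series;
  \<open>t_linear_eq_0_if_const\<close> extends it in one argument at a time.\<close>

lemma defect_nth_eq_0:
  assumes "n < N + 1"
  shows "fps_nth (defect s u v) n = 0"
proof (rule t_linear_eq_0_if_const[OF defect_t_linear(1) _ assms])
  fix a m assume "m < N + 1"
  then show "fps_nth (defect s (fps_const a) v) m = 0"
  proof (rule t_linear_eq_0_if_const[OF defect_t_linear(2), rotated])
    fix b n assume n: "n < N + 1"
    then have "{(i, j, k). i \<le> N \<and> j \<le> N \<and> k \<le> N \<and> i + j + k = n} = {(i, j, k). i + j + k = n}"
      and "{i. i \<le> N \<and> i \<le> n \<and> n - i \<le> N} = {0..n}"
      by auto
    then show "fps_nth (defect s (fps_const a) (fps_const b)) n = 0"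
      using hom[of n s a b] n by (simp add: defect_const_nth)
  qed
qed

lemma defect_nth:
  "fps_nth (defect s u v) (N + 1) = Ob_psi_bil N \<theta> s (fps_nth u 0) (fps_nth v 0)"
proof -
  have "fps_nth (defect s u v) (N + 1) = fps_nth (defect s (fps_const (fps_nth u 0)) v) (N + 1)"
    by (rule t_linear_nth_eq_const[OF defect_t_linear(1) defect_nth_eq_0])
  also have "\<dots> = fps_nth (defect s (fps_const (fps_nth u 0)) (fps_const (fps_nth v 0))) (N + 1)"
    by (rule t_linear_nth_eq_const[OF defect_t_linear(2) defect_nth_eq_0])
  \<comment> \<open>The bound on \<open>N + 1 - i\<close> excludes \<open>i = 0\<close>, so the sum
    starts at 1 as in \<open>Ob_psi_bil\<close>.\<close>
  also have "{i. i \<le> N \<and> i \<le> N + 1 \<and> N + 1 - i \<le> N} = {1..N}" by auto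
  then have "fps_nth (defect s (fps_const (fps_nth u 0)) (fps_const (fps_nth v 0))) (N + 1) =
    Ob_psi_bil N \<theta> s (fps_nth u 0) (fps_nth v 0)"
    unfolding defect_const_nth Ob_psi_bil_def by simp
  finally show ?thesis .
qed

lemma \<Psi>_nth_leading:
  "(\<And>n. n < m \<Longrightarrow> fps_nth w n = 0) \<Longrightarrow> fps_nth (\<Psi> w) m = psi \<theta> 0 (fps_nth w m)"
  using t_linear_nth_leading[OF \<Psi>_t_linear, of m w] by (simp add: tmap_nth_0)

text \<open>The mixed terms, with one inner product taken in the source and the outer one in the
  target, cancel in pairs. What remains is both bracketings with \<Psi> applied last and both with
  \<Psi> applied first.\<close>

lemma defect_tassoc:
  "\<nu> (leaf_op 2 y 0) (\<Psi> u) (defect (leaf_op 2 y 2) v w)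
    - defect (leaf_op 2 y 3) (\<mu> (leaf_op 2 y 1) u v) w
    + defect (leaf_op 2 y 0) u (\<mu> (leaf_op 2 y 2) v w)
    - \<nu> (leaf_op 2 y 3) (defect (leaf_op 2 y 1) u v) (\<Psi> w)
  = \<Psi> (D.tassoc y u v w) - E.tassoc y (\<Psi> u) (\<Psi> v) (\<Psi> w)"
  unfolding defect_def D.tassoc_def E.tassoc_def E.tprod_diff \<Psi>_diff by simp

lemma cobd_Ob_psi:
  "cobd (bil (FD \<theta> 0)) (pullback_lact (bil (FE \<theta> 0)) (psi \<theta> 0))
      (pullback_ract (bil (FE \<theta> 0)) (psi \<theta> 0)) 2 (Ob_psi N \<theta>) y as =
    psi \<theta> 0 (Ob_alg N (FD \<theta>) y as) - Ob_alg N (FE \<theta>) y (map (psi \<theta> 0) as)"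
proof (cases "y \<in> ntrees 3 \<and> length as = 3")
  case True
  then obtain a b c where as: "as = [a, b, c]"
    by (auto simp: eval_nat_numeral length_Suc_conv)
  have y: "y \<in> ntrees 3" using True by blast
  \<comment> \<open>In degree \<open>N + 1\<close> of \<open>defect_tassoc\<close> at constants, the
    defects become \<open>Ob_psi_bil\<close>, the associators \<open>Ob_alg\<close>, and the outer
    maps their undeformed versions. \<open>Ob_psi_del_leaf\<close> matches the defects with the
    faces of \<open>y\<close>.\<close>
  show ?thesis
    using arg_cong[OF defect_tassoc[of y "fps_const a" "fps_const b" "fps_const c"],
        of "\<lambda>u. fps_nth u (N + 1)"]
    unfolding as cobd_2[OF y] fps_add_nth fps_sub_nth Ob_psi_del_leaf[OF y]
    by (simp add: D.tassoc_nth[OF y, simplified] E.tassoc_nth[OF y, simplified]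
        D.tassoc_nth_eq_0[OF y] E.tprod_nth_leading \<Psi>_nth_leading
        defect_nth[simplified] defect_nth_eq_0 tprod_nth_0 tmap_nth_0)
next
  case False
  have "psi \<theta> 0 0 = 0" using additive.zero[OF additive_psi] by simp
  then show ?thesis using False by (auto simp: cobd_def Ob_alg_eq_0)
qed

end

section \<open>Multilinearity of the obstruction\<close>

lemma linear_compose':
  "Vector_Spaces.linear s1 s2 f \<Longrightarrow> Vector_Spaces.linear s2 s3 g \<Longrightarrow>
    Vector_Spaces.linear s1 s3 (\<lambda>x. g (f x))"
  by (simp add: Vector_Spaces.linear_iff)

lemma linear_diff_fun:
  "Vector_Spaces.linear s1 s2 f \<Longrightarrow> Vector_Spaces.linear s1 s2 g \<Longrightarrow>
    Vector_Spaces.linear s1 s2 (\<lambda>x. f x - g x)"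
  unfolding module_hom_iff_linear[symmetric]
  by (rule module_pair.module_hom_sub) (auto simp: module_pair_def module_hom_iff)

lemma linear_sum_fun:
  assumes "vector_space s1" "vector_space s2"
    and "\<And>i. i \<in> I \<Longrightarrow> Vector_Spaces.linear s1 s2 (f i)"
  shows "Vector_Spaces.linear s1 s2 (\<lambda>x. \<Sum>i\<in>I. f i x)"
  using assms by (intro vector_space_pair.linear_compose_sum) (auto simp: vector_space_pair_def)

lemma bilinear_over_linear:
  assumes "bilinear_over sA sB sC h"
  shows "Vector_Spaces.linear sA sC (\<lambda>a. h a b)" "Vector_Spaces.linear sB sC (h a)"
  using assms by (auto simp: bilinear_over_def)

lemma bilinear_over_imp_biadditive: "bilinear_over sA sB sC h \<Longrightarrow> biadditive h"
  by (simp add: bilinear_over_def biadditive_def Vector_Spaces.linear_iff additive_def)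

lemma CY_2_bilinear_over:
  assumes "F \<in> CY sD sM 2"
  shows "bilinear_over sD sD sM (bil F s)"
proof -
  have lin: "Vector_Spaces.linear sD sM (\<lambda>x. F y ([a, b][i := x]))"
    if "y \<in> {tree21, tree12}" "i < 2" for y a b i
    using assms that by (auto simp: CY_def ntrees_2 simp del: list_update.simps)
  have "Vector_Spaces.linear sD sM (\<lambda>x. F y [x, b])"
    "Vector_Spaces.linear sD sM (\<lambda>x. F y [a, x])" if "y \<in> {tree21, tree12}" for y a b
    using lin[OF that, of 0 a b] lin[OF that, of 1 a b] by simp_all
  then show ?thesis by (cases s) (auto simp: bilinear_over_def)
qed

lemma CY_1_linear:
  assumes "\<phi> \<in> CY sD sM 1"
  shows "Vector_Spaces.linear sD sM (lin \<phi>)"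
proof -
  \<comment> \<open>The entry \<open>0\<close> is a placeholder: \<open>CY\<close> expresses
    linearity in a slot by overwriting it.\<close>
  have "Vector_Spaces.linear sD sM (\<lambda>x. \<phi> tree1 ([0][0 := x]))"
    using assms unfolding CY_def ntrees_1 by (auto simp del: list_update.simps)
  then show ?thesis by (simp add: lin_def[abs_def])
qed

lemma Ob_alg_in_CY:
  assumes "vector_space sD" and "\<And>i s. i \<le> N \<Longrightarrow> bilinear_over sD sD sD (bil (F i) s)"
  shows "Ob_alg N F \<in> CY sD sD 3"
proof -
  have "Vector_Spaces.linear sD sD (\<lambda>x. Ob_alg N F y (as[n := x]))"
    if y: "y \<in> ntrees 3" and as: "length as = 3" and n: "n < 3" for y as n
  proof -
    obtain a b c where abc: "as = [a, b, c]"
      using as by (auto simp: eval_nat_numeral length_Suc_conv)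
    have "n \<in> {0, 1, 2}" using n by auto
    \<comment> \<open>In each bracketing a slot feeds the outer product either directly or through
      the inner one; the four composites below are the possible choices of sides.\<close>
    then have "Vector_Spaces.linear sD sD (\<lambda>x. prelie (F i) (F j) y (as[n := x]))"
      if "i \<le> N" "j \<le> N" for i j
      using that
      by (auto simp: abc prelie_eq[OF y] intro!: linear_diff_fun
          bilinear_over_linear[OF assms(2)]
          linear_compose'[OF bilinear_over_linear(1)[OF assms(2)] bilinear_over_linear(1)[OF assms(2)]]
          linear_compose'[OF bilinear_over_linear(2)[OF assms(2)] bilinear_over_linear(1)[OF assms(2)]]
          linear_compose'[OF bilinear_over_linear(1)[OF assms(2)] bilinear_over_linear(2)[OF assms(2)]]
          linear_compose'[OF bilinear_over_linear(2)[OF assms(2)] bilinear_over_linear(2)[OF assms(2)]])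
    then show ?thesis
      unfolding Ob_alg_def case_prod_beta by (intro linear_sum_fun assms(1)) auto
  qed
  then show ?thesis by (auto simp: CY_def Ob_alg_eq_0)
qed

lemma Ob_psi_in_CY:
  assumes "vector_space sD" "vector_space sE"
    and FD: "\<And>i s. i \<le> N \<Longrightarrow> bilinear_over sD sD sD (bil (FD \<theta> i) s)"
    and FE: "\<And>i s. i \<le> N \<Longrightarrow> bilinear_over sE sE sE (bil (FE \<theta> i) s)"
    and psi: "\<And>i. i \<le> N \<Longrightarrow> Vector_Spaces.linear sD sE (psi \<theta> i)"
  shows "Ob_psi N \<theta> \<in> CY sD sE 2"
proof -
  have l: "Vector_Spaces.linear sD sE (\<lambda>a. Ob_psi_bil N \<theta> s a b)"
    "Vector_Spaces.linear sD sE (Ob_psi_bil N \<theta> s a)" for s a b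
    unfolding Ob_psi_bil_def case_prod_beta
    by (intro linear_diff_fun linear_sum_fun assms(1,2);
        auto intro!: linear_compose'[OF psi bilinear_over_linear(1)[OF FE]]
          linear_compose'[OF psi bilinear_over_linear(2)[OF FE]]
          linear_compose'[OF bilinear_over_linear(1)[OF FD] psi]
          linear_compose'[OF bilinear_over_linear(2)[OF FD] psi])+
  have "Vector_Spaces.linear sD sE (\<lambda>x. Ob_psi N \<theta> y (as[n := x]))"
    if y: "y \<in> ntrees 2" and as: "length as = 2" and n: "n < 2" for y as n
  proof -
    obtain a b where ab: "as = [a, b]"
      using as by (auto simp: eval_nat_numeral length_Suc_conv)
    have "n \<in> {0, 1}" using n by auto
    then show ?thesis
      using y l unfolding ntrees_2 by (auto simp: ab Ob_psi_def tree_defs)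
  qed
  moreover have "Ob_psi N \<theta> y as = 0" if "y \<notin> ntrees 2 \<or> length as \<noteq> 2" for y as
    using that unfolding ntrees_2 Ob_psi_def by (auto split: list.split)
  ultimately show ?thesis by (auto simp: CY_def)
qed

section \<open>The cocycle condition for the three components together\<close>

theorem lemma6p2:
  fixes sD :: "'k::field \<Rightarrow> 'd::ab_group_add \<Rightarrow> 'd"
    and mD :: "dop \<Rightarrow> 'd \<Rightarrow> 'd \<Rightarrow> 'd"
    and sE :: "'k \<Rightarrow> 'e::ab_group_add \<Rightarrow> 'e"
    and mE :: "dop \<Rightarrow> 'e \<Rightarrow> 'e \<Rightarrow> 'e"
    and \<psi> :: "'d \<Rightarrow> 'e"
    and N :: nat
    and \<theta> :: "nat \<Rightarrow> ('d, 'e) mcochain"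
  assumes "dialgebra_morphism sD mD sE mE \<psi>"
    and "N > 0"
    and "deformation sD mD sE mE \<psi> N \<theta>"
  shows "cocycle_mor sD mD sE mE \<psi> 3 (Ob N \<theta>)"
proof -
  interpret dialgebra_morphism sD mD sE mE \<psi> by fact
  note def = assms(3)[unfolded deformation_def Let_def]
  have FD: "bilinear_over sD sD sD (bil (FD \<theta> i) s)"
    and FE: "bilinear_over sE sE sE (bil (FE \<theta> i) s)"
    and psi: "Vector_Spaces.linear sD sE (psi \<theta> i)" if "i \<le> N" for i s
  proof -
    have "FD \<theta> i \<in> CY sD sD 2" "FE \<theta> i \<in> CY sE sE 2" "snd (snd (\<theta> i)) \<in> CY sD sE 1"
      using def that by (auto simp: CY_mor_def FD_def FE_def mem_Times_iff)
    then show "bilinear_over sD sD sD (bil (FD \<theta> i) s)"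
      "bilinear_over sE sE sE (bil (FE \<theta> i) s)" "Vector_Spaces.linear sD sE (psi \<theta> i)"
      by (simp_all add: psi_def CY_2_bilinear_over CY_1_linear)
  qed
  have zero: "bil (FD \<theta> 0) = mD" "bil (FE \<theta> 0) = mE" "psi \<theta> 0 = \<psi>"
    using def by blast+
  interpret t: truncated_dialgebra_morphism N \<theta>
  proof (intro truncated_dialgebra_morphism.intro truncated_dialgebra.intro
      truncated_dialgebra_morphism_axioms.intro)
    show "additive (psi \<theta> i)" if "i \<le> N" for i
      using psi[OF that] by (simp add: Vector_Spaces.linear_iff additive_def)
  qed (use def FD FE bilinear_over_imp_biadditive in blast)+
  have "Ob N \<theta> \<in> CY_mor sD sE 3"
    unfolding Ob_def CY_mor_def
    using Ob_alg_in_CY[OF D.vector_space_axioms FD] Ob_alg_in_CY[OF E.vector_space_axioms FE]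
      Ob_psi_in_CY[OF D.vector_space_axioms E.vector_space_axioms FD FE psi]
    by simp
  \<comment> \<open>The pentagon handles the two algebra components. In the third,
    \<open>cobd_Ob_psi\<close> equates the coboundary in degree 2 = 3 - 1 with the difference from
    which \<open>cobd_mor\<close> subtracts it.\<close>
  moreover have "cobd_mor mD mE \<psi> 3 (Ob N \<theta>) = ((\<lambda>y as. 0), (\<lambda>y as. 0), (\<lambda>y as. 0))"
    using t.D.cobd_Ob_alg t.E.cobd_Ob_alg t.cobd_Ob_psi unfolding zero Ob_def by simp
  ultimately show ?thesis by (simp add: cocycle_mor_def)
qed

end
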